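(* Suppose that $q\equiv\pm1\pmod{12}$ and let $s\in\{1/2,-1/2\}\subset\mathbb{F}_q$, so that $c=1-s^2=3/4\in\mathcal{C}$. Then each monic irreducible factor $I(y)$ of $g_s(y)$ over $\mathbb{F}_q$ has the form $$I(y)=y^3-\frac{3}{2}y^2+\frac{9}{16}y-m$$ for some $m\in\mathbb{F}_q$.
   Context: $\mathbb{F}_q$ is a finite field with $q$ elements, $q$ a power of an odd prime; $n=(q+1)/2$; for $s\in\mathbb{F}_q$, $g_s(y) := y^n+(1-y)^n-s \in \mathbb{F}_q[y]$. $\rho$ is the quadratic character on $\mathbb{F}_q$ and $\mathcal{C} := \{a \in \mathbb{F}_q : \rho(a)=\rho(1-a)=1\}$. *)

theory Defs
  imports
    "HOL-Computational_Algebra.Polynomial"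
    "HOL-Library.Cardinality"
    "HOL-Number_Theory.Cong"
begin

text \<open>
  The field \<open>F_q\<close> is a type \<open>'a\<close> of sort \<open>{field, finite}\<close>, with \<open>q = CARD('a)\<close>; that \<open>q\<close> is a
  prime power is then automatic.
\<close>

definition quad_char :: "'a::{field, finite} \<Rightarrow> int" where
  "quad_char a = (if a = 0 then 0 else if \<exists>x. x ^ 2 = a then 1 else - 1)"

definition C_set :: "'a::{field, finite} set" where
  "C_set = {a. quad_char a = 1 \<and> quad_char (1 - a) = 1}"

text \<open>For odd \<open>q\<close>, the \<open>div\<close> in the exponent is exact.\<close>

definition half_exp :: "'a::{field, finite} itself \<Rightarrow> nat" where
  "half_exp _ = (CARD('a) + 1) div 2"

definition g_poly :: "'a::{field, finite} \<Rightarrow> 'a poly" where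
  "g_poly s = [:0, 1:] ^ half_exp TYPE('a) + (1 - [:0, 1:]) ^ half_exp TYPE('a) - [:s:]"

end

theory Submission
  imports "HOL-Algebra.Algebraic_Closure_Type" "HOL-Number_Theory.Residues" Defs
begin

text \<open>
  The proof is trigonometric. Let \<open>y\<close> be a root of \<open>g_s\<close> in the algebraic closure and write
  \<open>y = cos\<^sup>2 \<theta>\<close>, \<open>1 - y = sin\<^sup>2 \<theta>\<close>, \<open>Y = y^q = cos\<^sup>2 \<phi>\<close>, where \<open>cos \<phi> = (cos \<theta>)^q\<close> and
  \<open>sin \<phi> = (sin \<theta>)^q\<close>. As \<open>2 n = q + 1\<close>, the equation \<open>g_s(y) = 0\<close> says
  \<open>cos \<theta> cos \<phi> + sin \<theta> sin \<phi> = s\<close>, that is, \<open>cos (\<theta> - \<phi>) = \<plusminus>1/2\<close>. Hence \<open>\<theta>\<close> and \<open>\<phi>\<close> differ by a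
  multiple of \<open>\<pi>/3\<close>, so \<open>cos 6\<theta>\<close>, a polynomial of degree three in \<open>y\<close>, takes the same value at
  \<open>y\<close> and \<open>Y\<close>. Made monic and without its constant term this polynomial is
  \<open>h = y^3 - (3/2) y^2 + (9/16) y\<close>. Its value \<open>m\<close> at \<open>y\<close> is thus fixed by the \<open>q\<close>-th power map,
  which means \<open>m \<in> F_q\<close> (\<open>frobenius_root_cubic\<close>, \<open>power_CARD_fixed_imp_base\<close>).

  It remains to exclude irreducible factors of degree one and two, that is, to show that
  \<open>y^(q^2) \<noteq> y\<close> (\<open>frobenius_square_moves_root\<close>). Here the sine of the difference decides:
  \<open>sin\<^sup>2 (\<theta> - \<phi>) = 3/4\<close>, and since \<open>3\<close> is a square in \<open>F_q\<close> for \<open>q \<equiv> \<plusminus>1 (mod 12)\<close>, the sine is in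
  \<open>F_q\<close> and so is fixed by the \<open>q\<close>-th power map. But if \<open>y^(q^2) = y\<close>, that map interchanges
  \<open>\<theta>\<close> and \<open>\<phi>\<close> and therefore changes the sign of the sine.

  Consequently \<open>y\<close>, \<open>y^q\<close> and \<open>y^(q^2)\<close> are three distinct common roots of the irreducible factor
  and of the cubic \<open>h - m\<close>, and this forces the two to coincide (\<open>irreducible_eq_of_roots\<close>).

  The square roots \<open>cos \<theta>\<close> and \<open>sin \<theta>\<close> enter only through the products
  \<open>w = y^n = cos \<theta> cos \<phi>\<close> and \<open>v = (1 - y)^n = sin \<theta> sin \<phi>\<close>, so no choice of signs is ever made.
\<close>

section \<open>The Frobenius map of a finite field\<close>

lemma finite_field_power_CARD:
  fixes a :: "'a::{field, finite}"
  shows "a ^ CARD('a) = a"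
proof (cases "a = 0")
  case False
  have "a ^ (CARD('a) - 1) * \<Prod>(UNIV - {0}) = (\<Prod>b\<in>UNIV - {0}. a * b)"
    by (simp add: prod.distrib)
  also have "\<dots> = \<Prod>(UNIV - {0})"
    by (rule prod.reindex_bij_witness[of _ "\<lambda>b. b / a" "\<lambda>b. a * b"]) (use False in auto)
  finally have "a ^ (CARD('a) - 1) = 1"
    by simp
  moreover have "a ^ CARD('a) = a * a ^ (CARD('a) - 1)"
    by (metis power_minus_mult mult.commute zero_less_card_finite)
  ultimately show ?thesis
    by simp
qed (simp add: power_0_left)

lemma to_ac_power_CARD:
  fixes a :: "'a::{field, finite}"
  shows "to_ac a ^ CARD('a) = to_ac a"
  by (metis finite_field_power_CARD to_ac_power)

lemma card_range_to_ac: "card (range (to_ac :: 'a::{field, finite} \<Rightarrow> _)) = CARD('a)"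
  by (simp add: card_image inj_to_ac)

text \<open>
  As polynomials in \<open>X\<close>, both \<open>(x + X)^q\<close> and \<open>x^q + X^q\<close> are monic of degree \<open>q\<close>. Two such
  polynomials are equal as soon as they agree at \<open>q\<close> points, so additivity of the \<open>q\<close>-th power
  spreads from the base field to the whole closure.
\<close>

lemma power_CARD_add_lift:
  fixes x z :: "'a::{field, finite} alg_closure"
  assumes "\<And>a. (x + to_ac a) ^ CARD('a) = x ^ CARD('a) + to_ac a"
  shows "(x + z) ^ CARD('a) = x ^ CARD('a) + z ^ CARD('a)"
proof -
  let ?q = "CARD('a)"
  have q: "?q > 0" by simp
  have deg: "degree ([:x ^ ?q:] + monom 1 ?q) \<le> ?q"
    by (intro degree_add_le) (auto simp: degree_monom_le)
  have "[:x, 1:] ^ ?q = [:x ^ ?q:] + monom 1 ?q"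
  proof (rule poly_eqI_degree_lead_coeff[where n = ?q and A = "range to_ac"])
    show "coeff ([:x, 1:] ^ ?q) ?q = coeff ([:x ^ ?q:] + monom 1 ?q) ?q"
      using q by (simp add: coeff_linear_power coeff_pCons split: nat.split)
    show "degree ([:x, 1:] ^ ?q) \<le> ?q"
      by (simp add: degree_linear_power)
  qed (use deg in \<open>auto simp: card_range_to_ac poly_monom assms to_ac_power_CARD\<close>)
  from arg_cong[OF this, of "\<lambda>p. poly p z"] show ?thesis
    by (simp add: poly_monom)
qed

text \<open>
  The lifting step is applied twice: for \<open>x\<close> in the base field its hypothesis is Fermat's little
  theorem, and the result is the hypothesis for arbitrary \<open>x\<close>.
\<close>

lemma power_CARD_add:
  fixes x z :: "'a::{field, finite} alg_closure"
  shows "(x + z) ^ CARD('a) = x ^ CARD('a) + z ^ CARD('a)"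
proof (rule power_CARD_add_lift)
  fix a :: 'a
  have "(to_ac a + x) ^ CARD('a) = to_ac a ^ CARD('a) + x ^ CARD('a)"
    by (rule power_CARD_add_lift) (metis to_ac_add to_ac_power_CARD)
  then show "(x + to_ac a) ^ CARD('a) = x ^ CARD('a) + to_ac a"
    by (simp add: add.commute to_ac_power_CARD)
qed

lemma power_CARD_diff:
  fixes x z :: "'a::{field, finite} alg_closure"
  shows "(x - z) ^ CARD('a) = x ^ CARD('a) - z ^ CARD('a)"
  using power_CARD_add[of "x - z" z] by simp

text \<open>
  The elements of the base field are \<open>q\<close> roots of \<open>X^q - X\<close>, so they are all of its roots.
\<close>

lemma power_CARD_fixed_imp_base:
  fixes x :: "'a::{field, finite} alg_closure"
  assumes "x ^ CARD('a) = x"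
  shows "x \<in> range to_ac"
proof -
  let ?q = "CARD('a)"
  let ?p = "monom 1 ?q - monom 1 1 :: 'a alg_closure poly"
  have "card {0, 1 :: 'a} \<le> ?q"
    by (intro card_mono) auto
  then have q: "?q > 1" by simp
  have "coeff ?p ?q = 1" using q by auto
  then have nz: "?p \<noteq> 0" by (metis coeff_0 zero_neq_one)
  have "degree ?p \<le> ?q"
    using q by (intro degree_diff_le) (auto intro: order.trans[OF degree_monom_le])
  with card_poly_roots_bound[OF nz] have "card {x. poly ?p x = 0} \<le> ?q"
    by simp
  moreover have "range to_ac \<subseteq> {x. poly ?p x = 0}"
    by (auto simp: poly_monom to_ac_power_CARD)
  ultimately have "range to_ac = {x. poly ?p x = 0}"
    by (intro card_seteq poly_roots_finite nz) (auto simp: card_range_to_ac)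
  then show ?thesis
    using assms by (auto simp: poly_monom)
qed

section \<open>Polynomials over the base field, evaluated in its algebraic closure\<close>

definition ev :: "'a::field alg_closure \<Rightarrow> 'a poly \<Rightarrow> 'a alg_closure" where
  "ev x f = poly (map_poly to_ac f) x"

lemma ev_0 [simp]: "ev x 0 = 0"
  by (simp add: ev_def)

lemma ev_pCons [simp]: "ev x (pCons a f) = to_ac a + x * ev x f"
  by (simp add: ev_def map_poly_pCons)

lemma ev_1 [simp]: "ev x 1 = 1"
  by (simp add: one_pCons)

lemma ev_add [simp]: "ev x (f + g) = ev x f + ev x g"
  by (induction f g rule: poly_induct2) (simp_all add: algebra_simps)

lemma ev_diff [simp]: "ev x (f - g) = ev x f - ev x g"
  using ev_add[of x "f - g" g] by simp

lemma ev_smult [simp]: "ev x (smult a f) = to_ac a * ev x f"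
  by (induction f) (simp_all add: algebra_simps)

lemma ev_mult [simp]: "ev x (f * g) = ev x f * ev x g"
  by (induction f) (simp_all add: algebra_simps)

lemma ev_power [simp]: "ev x (f ^ k) = ev x f ^ k"
  by (induction k) simp_all

lemma ev_power_CARD:
  fixes f :: "'a::{field, finite} poly"
  shows "ev x f ^ CARD('a) = ev (x ^ CARD('a)) f"
  by (induction f) (simp_all add: power_CARD_add power_mult_distrib to_ac_power_CARD power_0_left)

lemma irreducible_has_root:
  fixes f :: "'a::field poly"
  assumes "irreducible f"
  obtains x where "ev x f = 0"
proof -
  have "degree f > 0"
    using assms by (auto simp: irreducible_def is_unit_iff_degree)
  then have "degree (map_poly to_ac f) > 0"
    by (simp add: degree_map_poly)
  with that show ?thesis
    unfolding ev_def by (metis alg_closed_imp_poly_has_root)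
qed

lemma ev_eq_0_imp_eq_0:
  fixes f :: "'a::field poly"
  assumes "\<And>x. x \<in> A \<Longrightarrow> ev x f = 0" and "degree f < card A"
  shows "f = 0"
proof -
  have "map_poly to_ac f = 0"
    by (rule poly_eqI_degree[where A = A]) (use assms in \<open>auto simp: ev_def degree_map_poly\<close>)
  then show ?thesis
    by (simp add: map_poly_eq_0_iff)
qed

text \<open>
  The remainder of \<open>f\<close> modulo \<open>h\<close> has more roots than its degree allows, so \<open>h\<close> divides \<open>f\<close>;
  as \<open>f\<close> is irreducible and both are monic, they are equal.
\<close>

lemma irreducible_eq_of_roots:
  fixes f h :: "'a::field poly"
  assumes f: "irreducible f" "lead_coeff f = 1" "\<And>x. x \<in> A \<Longrightarrow> ev x f = 0"
    and h: "degree h > 0" "lead_coeff h = 1" "\<And>x. x \<in> A \<Longrightarrow> ev x h = 0"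
    and A: "card A = degree h"
  shows "f = h"
proof -
  have "f mod h = 0"
  proof (rule ev_eq_0_imp_eq_0[where A = A])
    fix x assume x: "x \<in> A"
    have "ev x f = ev x (f div h * h + f mod h)" by simp
    then show "ev x (f mod h) = 0"
      unfolding ev_add ev_mult using f(3) h(3) x by simp
  next
    show "degree (f mod h) < card A"
      using A h(1) degree_mod_less[of h f] by (cases "h = 0") auto
  qed
  then obtain k where k: "f = h * k"
    by (auto simp: mod_eq_0_iff_dvd dvd_def)
  moreover have "\<not> is_unit h"
    using h(1) by (cases "h = 0") (auto simp: is_unit_iff_degree)
  ultimately have "is_unit k"
    using f(1) irreducibleD by blast
  then obtain c where c: "k = [:c:]"
    by (auto simp: is_unit_poly_iff)
  with k f(2) h(2) show ?thesis
    by (cases "c = 0") auto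
qed

section \<open>A square root of three\<close>

text \<open>
  The equation for \<open>z\<close> is the twelfth cyclotomic polynomial; the last identity is
  \<open>(2 cos (\<pi>/6))\<^sup>2 = 3\<close>.
\<close>

lemma primitive_12th_root_identities:
  fixes z w :: "'k::idom"
  assumes z4: "z ^ 4 = z ^ 2 - 1" and zw: "z * w = 1"
  shows "z ^ 12 = 1" "w ^ 12 = 1" "z ^ 11 = w" "w ^ 11 = z" "(z + w) ^ 2 = 3"
proof -
  have "z ^ 6 = z ^ 2 * z ^ 4" by (simp flip: power_add)
  also have "\<dots> = z ^ 4 - z ^ 2" unfolding z4
    by (simp add: z4 right_diff_distrib flip: power_add)
  finally have "z ^ 6 = - 1" using z4 by simp
  moreover have "z ^ 12 = (z ^ 6) ^ 2" by (simp flip: power_mult)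
  ultimately show z12: "z ^ 12 = 1" by simp
  have "z ^ 12 * w ^ 12 = 1" by (simp add: zw flip: power_mult_distrib)
  then show w12: "w ^ 12 = 1" using z12 by simp
  have shift: "x ^ 11 = x'" if "x ^ 12 = 1" "x * x' = 1" for x x' :: 'k
  proof -
    have "x ^ 11 = x ^ 11 * (x * x')" using that by simp
    also have "\<dots> = x ^ 12 * x'" by (simp add: mult_ac eval_nat_numeral)
    finally show ?thesis using that by simp
  qed
  show "z ^ 11 = w" "w ^ 11 = z"
    using shift z12 w12 zw by (simp_all add: mult.commute)
  have "z ^ 2 = z ^ 2 * (z * w) ^ 2" using zw by simp
  also have "\<dots> = z ^ 4 * w ^ 2" by (simp add: power_mult_distrib eval_nat_numeral)
  also have "\<dots> = (z * w) ^ 2 - w ^ 2"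
    unfolding z4 by (simp add: power_mult_distrib left_diff_distrib)
  finally have "z ^ 2 + w ^ 2 = 1" using zw by simp
  then show "(z + w) ^ 2 = 3" 
    using zw by (simp add: power2_sum mult.assoc)
qed

lemma cong_pm1_mod_12:
  fixes q :: nat
  assumes "[int q = 1] (mod 12) \<or> [int q = - 1] (mod 12)"
  shows "q mod 12 = 1 \<or> q mod 12 = 11"
proof -
  have "int q mod 12 = 1 \<or> int q mod 12 = 11"
    using assms by (simp add: cong_def)
  then have "int (q mod 12) = 1 \<or> int (q mod 12) = 11"
    by (simp only: zmod_int of_nat_numeral)
  then show ?thesis by linarith
qed

text \<open>
  For a primitive twelfth root of unity \<open>z\<close>, the element \<open>z + 1/z\<close> is a square root of three. The
  \<open>q\<close>-th power map fixes \<open>z\<close> and \<open>1/z\<close> if \<open>q \<equiv> 1\<close> and swaps them if \<open>q \<equiv> -1 (mod 12)\<close>; either way it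
  fixes their sum, which therefore lies in the base field.
\<close>

lemma sqrt_three_exists:
  fixes F :: "'a::{field, finite} itself"
  assumes "[int CARD('a) = 1] (mod 12) \<or> [int CARD('a) = - 1] (mod 12)"
  obtains t :: 'a where "t ^ 2 = 3"
proof -
  let ?q = "CARD('a)"
  let ?p = "[:1, 0, - 1, 0, 1:] :: 'a alg_closure poly"
  obtain z where "poly ?p z = 0"
    using alg_closed_imp_poly_has_root[of ?p] by auto
  then have z4: "z ^ 4 = z ^ 2 - 1"
    by (simp add: algebra_simps eval_nat_numeral)
  then have z0: "z \<noteq> 0" by auto
  define w where "w = inverse z"
  have zw: "z * w = 1" using z0 by (simp add: w_def)
  note z12 = primitive_12th_root_identities[OF z4 zw]
  define t where "t = z + w"
  have "t ^ 2 = 3" unfolding t_def by (rule z12)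
  have "?q mod 12 = 1 \<or> ?q mod 12 = 11"
    by (rule cong_pm1_mod_12[OF assms])
  moreover have red: "x ^ ?q = x ^ (?q mod 12)" if "x ^ 12 = 1" for x :: "'a alg_closure"
  proof -
    have "x ^ ?q = x ^ (12 * (?q div 12) + ?q mod 12)" by simp
    then show ?thesis
      unfolding power_add power_mult that by simp
  qed
  ultimately have "z ^ ?q + w ^ ?q = z + w"
    using z12 by (auto simp: red)
  then have "t ^ ?q = t"
    by (simp add: t_def power_CARD_add)
  then obtain t' where "t = to_ac t'"
    using power_CARD_fixed_imp_base by blast
  with \<open>t ^ 2 = 3\<close> have "to_ac (t' ^ 2) = to_ac 3" by simp
  then have "t' ^ 2 = 3" unfolding to_ac_eq_iff .
  with that show ?thesis .
qed

lemma prime_nonzero_of_not_dvd_CARD: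
  assumes "prime p" "\<not> p dvd CARD('a::{field, finite})"
  shows "of_nat p \<noteq> (0 :: 'a)"
proof
  assume "of_nat p = (0 :: 'a)"
  then have "CHAR('a) dvd p" by (simp add: of_nat_eq_0_iff_char_dvd)
  then have "CHAR('a) = p"
    using assms(1) CHAR_not_1' by (auto simp: prime_nat_iff)
  with CHAR_dvd_CARD[where ?'a = 'a] assms(2) show False by simp
qed

section \<open>Trigonometric identities\<close>

lemma half_power_squared:
  fixes x :: "'k::comm_monoid_mult"
  assumes "2 * n = q + 1"
  shows "(x ^ n) ^ 2 = x * x ^ q"
  using assms by (metis Suc_eq_plus1 mult.commute power_Suc power_mult)

text \<open>
  In the following identities \<open>y\<close>, \<open>Y\<close>, \<open>w\<close>, \<open>v\<close> play the roles of \<open>cos\<^sup>2 \<theta>\<close>, \<open>cos\<^sup>2 \<phi>\<close>,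
  \<open>cos \<theta> cos \<phi>\<close>, \<open>sin \<theta> sin \<phi>\<close>. The relation between \<open>y\<close> and \<open>Y\<close> results from eliminating \<open>v\<close> and
  then \<open>w\<close>; its left-hand side is sixteen times the quotient of \<open>h(Y) - h(y)\<close> by \<open>Y - y\<close>, where
  \<open>h\<close> is the invariant cubic.
\<close>

lemma root_relation:
  fixes y Y w v s :: "'k::idom"
  assumes w: "w ^ 2 = y * Y" and v: "v ^ 2 = (1 - y) * (1 - Y)"
    and wv: "w + v = s" and s: "4 * s ^ 2 = 1"
  shows "16 * (y ^ 2 + y * Y + Y ^ 2) - 24 * (y + Y) + 9 = 0"
proof -
  have "2 * s * w = s ^ 2 + w ^ 2 - v ^ 2"
    unfolding wv[symmetric] by (simp add: power2_eq_square algebra_simps)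
  also have "\<dots> = s ^ 2 + (y + Y) - 1"
    unfolding w v by (simp add: algebra_simps)
  finally have "4 * (2 * s * w) = 4 * (s ^ 2 + (y + Y) - 1)"
    by (rule arg_cong)
  also have "\<dots> = 4 * s ^ 2 + 4 * (y + Y) - 4"
    by (simp add: algebra_simps)
  finally have "8 * s * w = 4 * (y + Y) - 3"
    unfolding s by (simp add: algebra_simps)
  then have "(4 * (y + Y) - 3) ^ 2 = (8 * s * w) ^ 2"
    by simp
  also have "\<dots> = 16 * (4 * s ^ 2) * w ^ 2"
    by (simp add: power_mult_distrib)
  finally have "(4 * (y + Y) - 3) ^ 2 = 16 * (y * Y)"
    unfolding s w by simp
  then show ?thesis
    by (simp add: power2_eq_square algebra_simps)
qed

lemma root_relation_cubic:
  fixes y Y :: "'k::idom"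
  assumes "16 * (y ^ 2 + y * Y + Y ^ 2) - 24 * (y + Y) + 9 = 0"
  shows "16 * Y ^ 3 - 24 * Y ^ 2 + 9 * Y = 16 * y ^ 3 - 24 * y ^ 2 + 9 * y"
proof -
  have "(16 * Y ^ 3 - 24 * Y ^ 2 + 9 * Y) - (16 * y ^ 3 - 24 * y ^ 2 + 9 * y) =
      (Y - y) * (16 * (y ^ 2 + y * Y + Y ^ 2) - 24 * (y + Y) + 9)"
    by (simp add: power2_eq_square power3_eq_cube algebra_simps)
  then show ?thesis
    unfolding assms by simp
qed

text \<open>
  Given its sum and the squares of its entries, a pair is unique unless the sum vanishes. With this
  the signs of \<open>w^q = \<plusminus>w\<close> and \<open>v^q = \<plusminus>v\<close> will be determined.
\<close>

lemma summands_determined_by_squares: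
  fixes w v w' v' s :: "'k::idom"
  assumes "w' ^ 2 = w ^ 2" "v' ^ 2 = v ^ 2" "w' + v' = s" "w + v = s"
  shows "2 * s * w' = 2 * s * w"
proof -
  have eq: "2 * (a + b) * a = (a + b) ^ 2 + a ^ 2 - b ^ 2" for a b :: 'k
    by (simp add: power2_eq_square algebra_simps)
  show ?thesis
    using eq[of w' v'] eq[of w v] unfolding assms by simp
qed

text \<open>
  The element \<open>d\<close> is \<open>2 cos \<theta> sin \<theta> sin (\<phi> - \<theta>)\<close>: the factor \<open>cos \<theta> sin \<theta>\<close> makes the sine
  expressible in \<open>y\<close>, \<open>w\<close> and \<open>v\<close>. Its partner \<open>d'\<close> is \<open>2 cos \<phi> sin \<phi> sin (\<theta> - \<phi>)\<close>, with the angles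
  interchanged. The first identity is \<open>sin\<^sup>2 (\<theta> - \<phi>) = 1 - s\<^sup>2 = 3/4\<close>, the second expresses that the
  sine is odd.
\<close>

lemma sine_relations:
  fixes y Y w v s :: "'k::idom"
  assumes w: "w ^ 2 = y * Y" and v: "v ^ 2 = (1 - y) * (1 - Y)"
    and wv: "w + v = s" and s: "4 * s ^ 2 = 1"
  defines "d \<equiv> 2 * (y * v - (1 - y) * w)" and "d' \<equiv> 2 * (Y * v - (1 - Y) * w)"
  shows "d ^ 2 = 3 * (y * (1 - y))" and "y * (1 - y) * d' = - (w * v * d)"
proof -
  have "2 * v * w = s ^ 2 - v ^ 2 - w ^ 2"
    unfolding wv[symmetric] by (simp add: power2_eq_square algebra_simps)
  then have "4 * (2 * v * w) = 4 * (s ^ 2 - v ^ 2 - w ^ 2)"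
    by (rule arg_cong)
  also have "\<dots> = 1 - 4 * ((1 - y) * (1 - Y)) - 4 * (y * Y)"
    unfolding right_diff_distrib s v w by (simp add: algebra_simps)
  finally have vw: "4 * (2 * v * w) = 1 - 4 * ((1 - y) * (1 - Y)) - 4 * (y * Y)" .
  have "d ^ 2 = 4 * (y ^ 2 * v ^ 2 + (1 - y) ^ 2 * w ^ 2) - y * (1 - y) * (4 * (2 * v * w))"
    unfolding d_def by (simp add: power2_eq_square algebra_simps)
  also have "\<dots> = 3 * (y * (1 - y))"
    unfolding v w vw by (simp add: power2_eq_square algebra_simps)
  finally show "d ^ 2 = 3 * (y * (1 - y))" .
  have "y * (1 - y) * d' = 2 * ((1 - y) * v * (y * Y) - y * w * ((1 - y) * (1 - Y)))"
    unfolding d'_def by (simp add: algebra_simps)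
  also have "\<dots> = - (w * v * d)"
    unfolding w[symmetric] v[symmetric] d_def by (simp add: algebra_simps power2_eq_square)
  finally show "y * (1 - y) * d' = - (w * v * d)" .
qed

section \<open>The Frobenius orbit of a root\<close>

text \<open>
  If \<open>y^(q^2) = y\<close>, then \<open>d^q = d'\<close>. The product \<open>d d^q\<close> can now be computed in two ways. Read as
  \<open>d^(q + 1) = (d\<^sup>2)^n\<close>, it is \<open>3^n w v = 3 w v\<close>, where \<open>3^n = t^(q + 1) = t\<^sup>2\<close> since \<open>t\<close> is in the
  base field. Read as \<open>d d'\<close> and multiplied by \<open>y (1 - y)\<close>, it is \<open>-3 w v y (1 - y)\<close> by the sine
  relations. So \<open>w v y (1 - y) = 0\<close>, which only leaves \<open>y = 0\<close> or \<open>y = 1\<close>, where \<open>g_s\<close> takes the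
  value \<open>1 - s \<noteq> 0\<close>.
\<close>

lemma frobenius_square_moves_root:
  fixes y :: "'a::{field, finite} alg_closure" and s t :: 'a
  assumes two: "(2 :: 'a) \<noteq> 0" and three: "(3 :: 'a) \<noteq> 0" and t: "t ^ 2 = 3"
    and n: "2 * n = CARD('a) + 1"
    and s: "4 * s ^ 2 = 1" and root: "y ^ n + (1 - y) ^ n = to_ac s"
  shows "(y ^ CARD('a)) ^ CARD('a) \<noteq> y"
proof
  let ?q = "CARD('a)"
  assume fixed: "(y ^ ?q) ^ ?q = y"
  have nz2: "(2 :: 'a alg_closure) \<noteq> 0" and nz3: "(3 :: 'a alg_closure) \<noteq> 0"
    using two three by (metis to_ac_numeral to_ac_eq_0_iff)+
  define Y w v where "Y = y ^ ?q" and "w = y ^ n" and "v = (1 - y) ^ n"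
  note sq = half_power_squared[OF n]
  have Y1: "(1 - y) ^ ?q = 1 - Y"
    by (simp add: power_CARD_diff Y_def)
  have w2: "w ^ 2 = y * Y" and v2: "v ^ 2 = (1 - y) * (1 - Y)"
    unfolding w_def v_def sq Y1 by (simp_all add: Y_def)
  have wv: "w + v = to_ac s" using root by (simp add: w_def v_def)
  have "to_ac (4 * s ^ 2) = to_ac 1" using s by simp
  then have s': "4 * to_ac s ^ 2 = 1" by simp
  have s0: "to_ac s \<noteq> 0" using s by auto
  have Yq: "Y ^ ?q = y" using fixed by (simp add: Y_def)
  have Y1q: "(1 - Y) ^ ?q = 1 - y" by (simp add: power_CARD_diff Yq)
  have comm: "(x ^ k) ^ ?q = (x ^ ?q) ^ k" for x :: "'a alg_closure" and k
    by (simp add: mult.commute flip: power_mult)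
  have wq2: "(w ^ ?q) ^ 2 = w ^ 2"
    unfolding comm[symmetric] w2 power_mult_distrib Yq by (simp add: Y_def mult.commute)
  have vq2: "(v ^ ?q) ^ 2 = v ^ 2"
    unfolding comm[symmetric] v2 power_mult_distrib Y1 Y1q by (simp add: mult.commute)
  have wvq: "w ^ ?q + v ^ ?q = to_ac s"
    using wv by (metis power_CARD_add to_ac_power_CARD)
  have "2 * to_ac s * w ^ ?q = 2 * to_ac s * w"
    by (rule summands_determined_by_squares[OF wq2 vq2 wvq wv])
  then have wq: "w ^ ?q = w" using nz2 s0 by simp
  then have vq: "v ^ ?q = v" using wv wvq by (metis add_left_cancel)
  define d where "d = 2 * (y * v - (1 - y) * w)"
  have d2: "d ^ 2 = 3 * (y * (1 - y))"
    unfolding d_def by (rule sine_relations[OF w2 v2 wv s'])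
  have two_q: "(2 :: 'a alg_closure) ^ ?q = 2"
    using to_ac_power_CARD[of 2] by simp
  have dq: "d ^ ?q = 2 * (Y * v - (1 - Y) * w)"
    unfolding d_def power_mult_distrib power_CARD_diff wq vq two_q 
    by (simp add: Y_def)
  have three_n: "(3 :: 'a alg_closure) ^ n = 3"
  proof -
    have "to_ac (t ^ 2) = to_ac 3" using t by simp
    then have "to_ac t ^ 2 = 3" by simp
    then have "(3 :: 'a alg_closure) ^ n = (to_ac t ^ n) ^ 2"
      by (metis mult.commute power_mult)
    also have "\<dots> = 3"
      unfolding sq to_ac_power_CARD using \<open>to_ac t ^ 2 = 3\<close> by (simp add: power2_eq_square)
    finally show ?thesis .
  qed
  have "d * d ^ ?q = (d ^ n) ^ 2" by (simp add: sq)
  also have "\<dots> = (d ^ 2) ^ n" by (simp add: mult.commute flip: power_mult)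
  also have "\<dots> = 3 * (w * v)"
    unfolding d2 power_mult_distrib three_n by (simp add: w_def v_def)
  finally have prod: "d * d ^ ?q = 3 * (w * v)" .
  have conj: "y * (1 - y) * d ^ ?q = - (w * v * d)"
    unfolding dq unfolding d_def by (rule sine_relations[OF w2 v2 wv s'])
  have "3 * (w * v) * (y * (1 - y)) = d * (y * (1 - y) * d ^ ?q)"
    unfolding prod[symmetric] by (simp add: mult_ac)
  also have "\<dots> = - (w * v) * d ^ 2"
    unfolding conj by (simp add: power2_eq_square)
  also have "\<dots> = - (3 * (w * v) * (y * (1 - y)))"
    unfolding d2 by simp
  finally have "2 * (3 * (w * v) * (y * (1 - y))) = 0"
    unfolding mult_2 by (simp only: eq_neg_iff_add_eq_0)
  then have "w * v * (y * (1 - y)) = 0"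
    using nz2 nz3 by (metis mult.assoc mult_eq_0_iff)
  moreover have "n > 0" using n by (cases n) auto
  ultimately have "y = 0 \<or> y = 1" by (auto simp: w_def v_def)
  then have "to_ac s = 1"
    using wv \<open>n > 0\<close> by (auto simp: w_def v_def power_0_left)
  with s' have "(4 :: 'a alg_closure) - 1 = 0" by simp
  with nz3 show False by simp
qed

text \<open>
  Up to an affine change, \<open>h\<close> is \<open>cos 6\<theta>\<close> as a function of \<open>y = cos\<^sup>2 \<theta>\<close>, which does not notice the
  shift of \<open>\<theta>\<close> by a multiple of \<open>\<pi>/3\<close>.
\<close>

lemma frobenius_root_cubic:
  fixes y :: "'a::{field, finite} alg_closure" and s :: 'a
  assumes two: "(2 :: 'a) \<noteq> 0"
    and n: "2 * n = CARD('a) + 1"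
    and s: "4 * s ^ 2 = 1" and root: "y ^ n + (1 - y) ^ n = to_ac s"
  defines "h \<equiv> [:0, 9 / 16, - (3 / 2), 1:] :: 'a poly"
  shows "ev (y ^ CARD('a)) h = ev y h"
proof -
  let ?q = "CARD('a)"
  have nz2: "(2 :: 'a alg_closure) \<noteq> 0"
    using two by (metis to_ac_numeral to_ac_eq_0_iff)
  have "(2 :: 'a alg_closure) ^ 4 \<noteq> 0" using nz2 by (simp del: power_numeral)
  then have nz16: "(16 :: 'a alg_closure) \<noteq> 0" by simp
  define Y where "Y = y ^ ?q"
  note sq = half_power_squared[OF n]
  have "to_ac (4 * s ^ 2) = to_ac 1" using s by simp
  then have s': "4 * to_ac s ^ 2 = 1" by simp
  have rel: "16 * (y ^ 2 + y * Y + Y ^ 2) - 24 * (y + Y) + 9 = 0"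
    using sq[of y] sq[of "1 - y"] root s'
    by (intro root_relation[where w = "y ^ n" and v = "(1 - y) ^ n" and s = "to_ac s"])
      (simp_all add: power_CARD_diff Y_def)
  have h: "16 * ev x h = 16 * x ^ 3 - 24 * x ^ 2 + 9 * x" for x
  proof -
    have c: "16 * (9 / 16) = (9 :: 'a alg_closure)" "16 * (3 / 2) = (24 :: 'a alg_closure)"
      using nz2 nz16 by (simp_all add: field_simps)
    have "16 * ev x h = 16 * x ^ 3 - 16 * (3 / 2) * x ^ 2 + 16 * (9 / 16) * x"
      unfolding h_def by (simp add: algebra_simps power2_eq_square power3_eq_cube)
    then show ?thesis unfolding c .
  qed
  have "16 * ev Y h = 16 * ev y h"
    unfolding h by (rule root_relation_cubic[OF rel])
  then show ?thesis
    using nz16 by (simp add: Y_def)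
qed

theorem corollary4p6:
  fixes s :: "'a::{field, finite}" and q :: nat
  assumes "q = CARD('a)"
    and "[int q = 1] (mod 12) \<or> [int q = - 1] (mod 12)"
    and "s \<in> {1 / 2, - (1 / 2)}"
  shows "1 - s ^ 2 = 3 / 4 \<and> 3 / 4 \<in> (C_set :: 'a set) \<and>
    (\<forall>I :: 'a poly. lead_coeff I = 1 \<longrightarrow> irreducible I \<longrightarrow> I dvd g_poly s \<longrightarrow>
      (\<exists>m :: 'a. I = [:0, 1:] ^ 3 - [:3 / 2:] * [:0, 1:] ^ 2 + [:9 / 16:] * [:0, 1:] - [:m:]))"
proof (intro conjI allI impI)
  have "q mod 12 = 1 \<or> q mod 12 = 11"
    by (rule cong_pm1_mod_12[OF assms(2)])
  then have "\<not> 2 dvd q" "\<not> 3 dvd q" by presburger+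
  then have two: "(2 :: 'a) \<noteq> 0" and three: "(3 :: 'a) \<noteq> 0"
    using prime_nonzero_of_not_dvd_CARD[of 2, where ?'a = 'a]
      prime_nonzero_of_not_dvd_CARD[of 3, where ?'a = 'a] assms(1) by auto
  have "(2 :: 'a) ^ 2 \<noteq> 0" using two by (simp del: power_numeral)
  then have four: "(4 :: 'a) \<noteq> 0" by simp
  obtain t :: 'a where t: "t ^ 2 = 3"
    using sqrt_three_exists[where ?'a = 'a] assms(1,2) by auto
  have s4: "4 * s ^ 2 = 1"
  proof -
    have "s ^ 2 = (1 / 2) ^ 2" using assms(3) by (metis insertE empty_iff power2_minus)
    then show ?thesis using four by (simp only: power_divide) simp
  qed
  then have s2: "s ^ 2 = 1 / 4" using four by (simp add: field_simps)
  show "1 - s ^ 2 = 3 / 4"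
    unfolding s2 using four by (simp add: field_simps)
  have qc: "quad_char (x ^ 2) = 1" if "x \<noteq> 0" for x :: 'a
    using that by (auto simp: quad_char_def)
  have "(t / 2) ^ 2 = 3 / 4" "(1 / 2) ^ 2 = 1 - (3 / 4 :: 'a)"
    using four by (simp_all add: power_divide t field_simps)
  moreover have "t / 2 \<noteq> 0" "1 / 2 \<noteq> (0 :: 'a)" using t three two by auto
  ultimately show "3 / 4 \<in> (C_set :: 'a set)"
    using qc[of "t / 2"] qc[of "1 / 2"] unfolding C_set_def mem_Collect_eq by metis
  fix I :: "'a poly"
  assume I: "lead_coeff I = 1" "irreducible I" "I dvd g_poly s"
  define n where "n = half_exp TYPE('a)"
  have n: "2 * n = CARD('a) + 1"
    using \<open>\<not> 2 dvd q\<close> assms(1) by (simp add: n_def half_exp_def)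
  obtain y where y: "ev y I = 0"
    using irreducible_has_root[OF I(2)] .
  have "ev y (g_poly s) = 0"
    using I(3) y by auto
  then have root: "y ^ n + (1 - y) ^ n = to_ac s"
    by (simp add: g_poly_def n_def)
  define Y Z where "Y = y ^ CARD('a)" and "Z = Y ^ CARD('a)"
  define h where "h = [:0, 9 / 16, - (3 / 2), 1 :: 'a:]"
  have hY: "ev Y h = ev y h"
    unfolding h_def Y_def by (rule frobenius_root_cubic[OF two n s4 root])
  then have "ev y h ^ CARD('a) = ev y h"
    by (simp add: ev_power_CARD Y_def)
  then obtain m where m: "ev y h = to_ac m"
    using power_CARD_fixed_imp_base by blast
  have hZ: "ev Z h = to_ac m"
    unfolding Z_def ev_power_CARD[symmetric] hY m by (rule to_ac_power_CARD)
  have Zy: "Z \<noteq> y"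
    unfolding Z_def Y_def by (rule frobenius_square_moves_root[OF two three t n s4 root])
  then have Yy: "Y \<noteq> y" by (auto simp: Z_def Y_def)
  have "(Y - y) ^ CARD('a) = Z - Y"
    by (simp add: power_CARD_diff Z_def Y_def)
  then have ZY: "Z \<noteq> Y" using Yy by auto
  have "I = h - [:m:]"
  proof (rule irreducible_eq_of_roots[where A = "{y, Y, Z}"])
    show "ev x I = 0" if "x \<in> {y, Y, Z}" for x
      using that y ev_power_CARD[of y I] ev_power_CARD[of Y I]
      by (auto simp: Y_def Z_def power_0_left)
    show "ev x (h - [:m:]) = 0" if "x \<in> {y, Y, Z}" for x
      using that hY hZ m by auto
  qed (use I Zy Yy ZY in \<open>auto simp: h_def\<close>)
  then show "\<exists>m. I = [:0, 1:] ^ 3 - [:3 / 2:] * [:0, 1:] ^ 2 + [:9 / 16:] * [:0, 1:] - [:m:]"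
    by (intro exI[of _ m]) (simp add: h_def eval_nat_numeral)
qed

end
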